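(* Let $\theta\in\mathbb{C}$, $\theta\neq 0$, and let $A$ be the one-parametric filiform Leibniz algebra of dimension $n$ with parameter $\theta$, i.e. the complex algebra with basis $\{e_1,\dots,e_n\}$ and products $e_ie_1=e_{i+1}$ for $2\le i\le n-1$, $e_1e_2=\theta e_n$ (all other products of basis elements zero). Consider the following gradings of $A$. (A) The $\mathbb{Z}_2$-grading $A=\langle e_1\rangle_{\overline 0}\oplus\langle e_2,e_3,\dots,e_n\rangle_{\overline 1}$. (B) For any divisor $t\neq 1$ of $n-3$, writing $n-3=rt$, the $\mathbb{Z}_t$-grading in which $e_1$ has degree $\overline 1$ and $e_j$ has degree $\overline{j-2}$ for $2\le j\le n$; that is, $A_{\overline 1}=\langle e_1\rangle\oplus\langle e_3,e_{t+3},\dots,e_{(r-1)t+3}\rangle\oplus\langle e_n\rangle$, $A_{\overline s}=\langle e_{s+2},e_{t+s+2},\dots,e_{(r-1)t+s+2}\rangle$ for $2\le s\le t-1$, and $A_{\overline 0}=\langle e_2\rangle\oplus\langle e_{t+2},e_{2t+2},\dots,e_{rt+2}\rangle$. (C) For any divisor $t\ne 1$ of $n-3$, writing $n-3=rt$, the $\mathbb{Z}_t\times\mathbb{Z}$-grading in which $e_1$ has degree $(\overline 1,0)$ and $e_j$ has degree $(\overline{j-3},1)$ for $2\le j\le n$; that is, $A_{(\overline 1,0)}=\langle e_1\rangle$, $A_{(\overline 0,1)}=\langle e_3,e_{t+3},\dots,e_{(r-1)t+3}\rangle\oplus\langle e_n\rangle$, $A_{(\overline s,1)}=\langle e_{s+3},e_{t+s+3},\dots,e_{(r-1)t+s+3}\rangle$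 for $1\le s\le t-2$, and $A_{(\overline{t-1},1)}=\langle e_2\rangle\oplus\langle e_{t+2},e_{2t+2},\dots,e_{rt+2}\rangle$. (D) For any divisor $t\neq 1$ of $n-3$ and any $\tau\in\{0,\dots,t-2\}$, the $\mathbb{Z}_t$-grading in which $e_1$ has degree $\overline 1$ and $e_j$ has degree $\overline{j-3-\tau}$ for $2\le j\le n$. Then: (i) If $n=4$, any abelian group grading of $A$ is equivalent either to the trivial grading or to the grading (A). (ii) If $n\ge 5$, any abelian group grading of $A$ is equivalent either to the trivial grading, or to the grading (A), or to one of the gradings in (B), or to one of the gradings in (C), or to one of the gradings in (D).
   Context: A Leibniz algebra is a complex vector space with a bilinear multiplication satisfying $x(yz)=(xy)z-(xz)y$. For a group $G$ (written additively), a $G$-grading of an algebra $L$ is a decomposition $L=\bigoplus_{g\in G}L_g$ with $L_gL_h\subset L_{g+h}$; its support is $\{g: L_g\ne 0\}$. The grading groups are abelian and generated by the support. The trivial grading is $A=A_0$. $\langle v_1,\dots,v_k\rangle_g$ denotes the homogeneous subspace of degree $g$, spanned by $v_1,\dots,v_k$; unlisted homogeneous subspaces are zero. When degrees of basis elements are given, the homogeneous subspace of degree $g$ is the span of the basis elements of degree $g$; bars denote residue classes modulo $t$ (modulo $2$ in (A)). Two gradings of $L$ are equivalent if there are a bijection $\sigma$ between their supports and an algebra automorphism $\varphi$ of $L$ with $\varphi(L_g)=L_{\sigma(g)}$ for every $g$ in the first support (where $L_{\sigma(g)}$ is the component of the second grading). *)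

theory Defs
  imports Complex_Main "HOL-Algebra.Elementary_Groups"
begin

section \<open>Complex algebras\<close>

text \<open>
  A complex vector space is given by a scaling map on a whole type, a (not necessarily
  associative) algebra by a further binary operation on that type. The qualified
  \<^verbatim>\<open>Modules.module\<close> is the locale underlying \<^verbatim>\<open>vector_space\<close>, not the module locale of HOL-Algebra.
\<close>

definition complex_algebra :: "(complex \<Rightarrow> 'a::ab_group_add \<Rightarrow> 'a) \<Rightarrow> ('a \<Rightarrow> 'a \<Rightarrow> 'a) \<Rightarrow> bool" where
  "complex_algebra scale mul \<longleftrightarrow>
     vector_space scale \<and>
     (\<forall>x. Vector_Spaces.linear scale scale (\<lambda>y. mul x y)) \<and>
     (\<forall>y. Vector_Spaces.linear scale scale (\<lambda>x. mul x y))"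

definition leibniz_algebra :: "(complex \<Rightarrow> 'a::ab_group_add \<Rightarrow> 'a) \<Rightarrow> ('a \<Rightarrow> 'a \<Rightarrow> 'a) \<Rightarrow> bool" where
  "leibniz_algebra scale mul \<longleftrightarrow>
     complex_algebra scale mul \<and>
     (\<forall>x y z. mul x (mul y z) = mul (mul x y) z - mul (mul x z) y)"

definition algebra_automorphism ::
  "(complex \<Rightarrow> 'a::ab_group_add \<Rightarrow> 'a) \<Rightarrow> ('a \<Rightarrow> 'a \<Rightarrow> 'a) \<Rightarrow> ('a \<Rightarrow> 'a) \<Rightarrow> bool" where
  "algebra_automorphism scale mul \<phi> \<longleftrightarrow>
     bij \<phi> \<and> Vector_Spaces.linear scale scale \<phi> \<and> (\<forall>x y. \<phi> (mul x y) = mul (\<phi> x) (\<phi> y))"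

definition indexed_basis :: "(complex \<Rightarrow> 'a::ab_group_add \<Rightarrow> 'a) \<Rightarrow> nat \<Rightarrow> (nat \<Rightarrow> 'a) \<Rightarrow> bool" where
  "indexed_basis scale n e \<longleftrightarrow>
     inj_on e {1..n} \<and>
     \<not> Modules.module.dependent scale (e ` {1..n}) \<and>
     Modules.module.span scale (e ` {1..n}) = UNIV"

definition one_parametric_filiform ::
  "(complex \<Rightarrow> 'a::ab_group_add \<Rightarrow> 'a) \<Rightarrow> ('a \<Rightarrow> 'a \<Rightarrow> 'a) \<Rightarrow> nat \<Rightarrow> complex \<Rightarrow> (nat \<Rightarrow> 'a) \<Rightarrow> bool" where
  "one_parametric_filiform scale mul n \<theta> e \<longleftrightarrow>
     complex_algebra scale mul \<and> indexed_basis scale n e \<and>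
     (\<forall>i\<in>{1..n}. \<forall>j\<in>{1..n}. mul (e i) (e j) =
        (if 2 \<le> i \<and> i < n \<and> j = 1 then e (i + 1)
         else if i = 1 \<and> j = 2 then scale \<theta> (e n)
         else 0))"


section \<open>Group gradings\<close>

text \<open>
  The grading group is a HOL-Algebra group, hence written multiplicatively. A family of
  homogeneous components is a function on the group type whose values outside the carrier
  are irrelevant.
\<close>

definition direct_sum_decomposition ::
  "(complex \<Rightarrow> 'a::ab_group_add \<Rightarrow> 'a) \<Rightarrow> 'g set \<Rightarrow> ('g \<Rightarrow> 'a set) \<Rightarrow> bool" where
  "direct_sum_decomposition scale I L \<longleftrightarrow>
     (\<forall>g\<in>I. Modules.module.subspace scale (L g)) \<and>
     Modules.module.span scale (\<Union>g\<in>I. L g) = UNIV \<and>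
     (\<forall>F x. finite F \<longrightarrow> F \<subseteq> I \<longrightarrow> (\<forall>g\<in>F. x g \<in> L g) \<longrightarrow> (\<Sum>g\<in>F. x g) = 0 \<longrightarrow> (\<forall>g\<in>F. x g = 0))"

definition grading_support :: "('g, 'm) monoid_scheme \<Rightarrow> ('g \<Rightarrow> 'a::zero set) \<Rightarrow> 'g set" where
  "grading_support G L = {g \<in> carrier G. L g \<noteq> {0}}"

definition abelian_group_grading ::
  "(complex \<Rightarrow> 'a::ab_group_add \<Rightarrow> 'a) \<Rightarrow> ('a \<Rightarrow> 'a \<Rightarrow> 'a) \<Rightarrow> ('g, 'm) monoid_scheme \<Rightarrow> ('g \<Rightarrow> 'a set) \<Rightarrow> bool" where
  "abelian_group_grading scale mul G L \<longleftrightarrow>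
     comm_group G \<and>
     direct_sum_decomposition scale (carrier G) L \<and>
     (\<forall>g\<in>carrier G. \<forall>h\<in>carrier G. \<forall>x\<in>L g. \<forall>y\<in>L h. mul x y \<in> L (g \<otimes>\<^bsub>G\<^esub> h)) \<and>
     generate G (grading_support G L) = carrier G"

definition equivalent_gradings ::
  "(complex \<Rightarrow> 'a::ab_group_add \<Rightarrow> 'a) \<Rightarrow> ('a \<Rightarrow> 'a \<Rightarrow> 'a) \<Rightarrow>
   ('g, 'm) monoid_scheme \<Rightarrow> ('g \<Rightarrow> 'a set) \<Rightarrow> ('h, 'k) monoid_scheme \<Rightarrow> ('h \<Rightarrow> 'a set) \<Rightarrow> bool" where
  "equivalent_gradings scale mul G L H M \<longleftrightarrow>
     abelian_group_grading scale mul G L \<and>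
     abelian_group_grading scale mul H M \<and>
     (\<exists>\<sigma> \<phi>. bij_betw \<sigma> (grading_support G L) (grading_support H M) \<and>
            algebra_automorphism scale mul \<phi> \<and>
            (\<forall>g\<in>grading_support G L. \<phi> ` L g = M (\<sigma> g)))"

definition trivial_grading :: "('g, 'm) monoid_scheme \<Rightarrow> 'g \<Rightarrow> 'a::ab_group_add set" where
  "trivial_grading G g = (if g = \<one>\<^bsub>G\<^esub> then UNIV else {0})"

definition degree_grading ::
  "(complex \<Rightarrow> 'a::ab_group_add \<Rightarrow> 'a) \<Rightarrow> nat \<Rightarrow> (nat \<Rightarrow> 'a) \<Rightarrow> (nat \<Rightarrow> 'g) \<Rightarrow> 'g \<Rightarrow> 'a set" where
  "degree_grading scale n e deg g = Modules.module.span scale (e ` {j \<in> {1..n}. deg j = g})"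


section \<open>Degrees of the basis elements\<close>

text \<open>
  Residue classes modulo \<open>t\<close> are represented by their least nonnegative representatives,
  the elements of \<^term>\<open>integer_mod_group t\<close> for \<open>t > 0\<close>. The index \<open>j\<close> is converted to an
  integer before subtracting, as \<open>j - 3 - \<tau>\<close> may be negative.
\<close>

definition degA :: "nat \<Rightarrow> int" where
  "degA j = (if j = 1 then 0 else 1)"

definition degB :: "nat \<Rightarrow> nat \<Rightarrow> int" where
  "degB t j = (if j = 1 then 1 else int j - 2) mod int t"

definition degC :: "nat \<Rightarrow> nat \<Rightarrow> int \<times> int" where
  "degC t j = (if j = 1 then (1 mod int t, 0) else ((int j - 3) mod int t, 1))"

definition degD :: "nat \<Rightarrow> nat \<Rightarrow> nat \<Rightarrow> int" where
  "degD t \<tau> j = (if j = 1 then 1 else int j - 3 - int \<tau>) mod int t"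


section \<open>Consistency of the definitions\<close>

lemma degree_grading_mult:
  assumes A: "one_parametric_filiform scale mul n \<theta> e"
    and m1: "\<And>i. 2 \<le> i \<Longrightarrow> i < n \<Longrightarrow> deg i \<otimes>\<^bsub>G\<^esub> deg 1 = deg (i + 1)"
    and m2: "2 \<le> n \<Longrightarrow> deg 1 \<otimes>\<^bsub>G\<^esub> deg 2 = deg n"
    and x: "x \<in> degree_grading scale n e deg g" and y: "y \<in> degree_grading scale n e deg h"
  shows "mul x y \<in> degree_grading scale n e deg (g \<otimes>\<^bsub>G\<^esub> h)"
proof -
  interpret vector_space scale
    using A by (simp add: one_parametric_filiform_def complex_algebra_def)
  have l1: "Vector_Spaces.linear scale scale (\<lambda>y. mul x y)" for x
    using A by (simp add: one_parametric_filiform_def complex_algebra_def)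
  have l2: "Vector_Spaces.linear scale scale (\<lambda>x. mul x y)" for y
    using A by (simp add: one_parametric_filiform_def complex_algebra_def)
  have z: "mul 0 y = 0" "mul x 0 = 0" for x y
    using l1[of x] l2[of y] by (metis Vector_Spaces.linear_iff scale_zero_left)+
  let ?D = "degree_grading scale n e deg (g \<otimes>\<^bsub>G\<^esub> h)"
  have sD: "subspace ?D" by (simp add: degree_grading_def)
  have b: "mul (e i) (e j) \<in> ?D"
    if "i \<in> {1..n}" "j \<in> {1..n}" "deg i = g" "deg j = h" for i j
  proof -
    have p: "mul (e i) (e j) =
        (if 2 \<le> i \<and> i < n \<and> j = 1 then e (i + 1)
         else if i = 1 \<and> j = 2 then scale \<theta> (e n) else 0)"
      using A that by (simp add: one_parametric_filiform_def)
    have "e (i + 1) \<in> ?D" if "2 \<le> i" "i < n" "j = 1"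
      unfolding degree_grading_def using m1[of i] that \<open>deg i = g\<close> \<open>deg j = h\<close>
      by (intro span_base imageI) auto
    moreover have "scale \<theta> (e n) \<in> ?D" if "i = 1" "j = 2"
      unfolding degree_grading_def using m2 that \<open>j \<in> {1..n}\<close> \<open>deg i = g\<close> \<open>deg j = h\<close>
      by (intro span_scale span_base imageI) auto
    ultimately show ?thesis using sD by (auto simp: p subspace_0)
  qed
  have c: "mul (e i) y \<in> ?D" if "i \<in> {1..n}" "deg i = g" for i
    using y[unfolded degree_grading_def]
  proof (induction y rule: span_induct)
    case base
    show ?case
      using sD l1[of "e i"] by (auto simp: subspace_def Vector_Spaces.linear_iff z)
  qed (use b that in auto)
  show ?thesis
    using x[unfolded degree_grading_def]
  proof (induction x rule: span_induct)
    case base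
    show ?case
      using sD l2[of y] by (auto simp: subspace_def Vector_Spaces.linear_iff z)
  qed (use c in auto)
qed

lemma degree_grading_direct_sum:
  assumes "vector_space scale" and B: "indexed_basis scale n e"
    and deg: "\<And>j. j \<in> {1..n} \<Longrightarrow> deg j \<in> I"
  shows "direct_sum_decomposition scale I (degree_grading scale n e deg)"
proof -
  interpret vector_space scale by fact
  let ?L = "degree_grading scale n e deg"
  let ?S = "\<lambda>g. e ` {j \<in> {1..n}. deg j = g}"
  let ?B = "e ` {1..n}"
  have ind: "independent ?B" and inj: "inj_on e {1..n}" and sp: "span ?B = UNIV"
    using B by (auto simp: indexed_basis_def)
  have "e j \<in> ?L (deg j)" if "j \<in> {1..n}" for j
    unfolding degree_grading_def using that by (intro span_base imageI) simp
  then have "?B \<subseteq> (\<Union>g\<in>I. ?L g)" using deg by blast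
  from span_mono[OF this] have s: "span (\<Union>g\<in>I. ?L g) = UNIV"
    unfolding sp by (rule top.extremum_uniqueI)
  have "x g = 0" if F: "finite F" "\<forall>g\<in>F. x g \<in> ?L g" "(\<Sum>g\<in>F. x g) = 0" "g \<in> F" for F x g
  proof -
    have xg: "x g \<in> span (?S g)" using F by (auto simp: degree_grading_def)
    have "(\<Sum>g\<in>F. x g) = x g + (\<Sum>h\<in>F - {g}. x h)"
      using F by (simp add: sum.remove)
    then have "x g = - (\<Sum>h\<in>F - {g}. x h)"
      using F(3) by (simp add: eq_neg_iff_add_eq_0)
    moreover have "x h \<in> span (?B - ?S g)" if "h \<in> F - {g}" for h
    proof -
      have "?S h \<subseteq> ?B - ?S g" using inj that by (auto dest: inj_onD)
      from span_mono[OF this] show ?thesis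
        using F(2) that unfolding degree_grading_def by blast
    qed
    ultimately have xr: "x g \<in> span (?B - ?S g)" by (metis (no_types, lifting) span_neg span_sum)
    have r: "representation ?B (x g) b = 0" for b
    proof (cases "b \<in> ?S g")
      case True
      have "representation ?B (x g) = representation (?B - ?S g) (x g)"
        by (rule representation_extend[OF ind xr]) auto
      then show ?thesis using True representation_ne_zero[of "?B - ?S g" "x g" b] by auto
    next
      case False
      have "representation ?B (x g) = representation (?S g) (x g)"
        by (rule representation_extend[OF ind xg]) auto
      then show ?thesis using False representation_ne_zero[of "?S g" "x g" b] by metis
    qed
    have "(\<Sum>b | representation ?B (x g) b \<noteq> 0. scale (representation ?B (x g) b) b) = x g"
      by (rule sum_nonzero_representation_eq[OF ind]) (simp only: sp UNIV_I)
    then show ?thesis unfolding r by simp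
  qed
  moreover have "subspace (?L g)" for g by (simp add: degree_grading_def)
  ultimately show ?thesis
    unfolding direct_sum_decomposition_def using s by blast
qed

lemma degree_grading_support:
  assumes "vector_space scale" and B: "indexed_basis scale n e"
    and deg: "\<And>j. j \<in> {1..n} \<Longrightarrow> deg j \<in> carrier G"
  shows "grading_support G (degree_grading scale n e deg) = deg ` {1..n}"
proof -
  interpret vector_space scale by fact
  let ?L = "degree_grading scale n e deg"
  have "0 \<notin> e ` {1..n}"
    using B dependent_zero unfolding indexed_basis_def by blast
  moreover have "e j \<in> ?L (deg j)" if "j \<in> {1..n}" for j
    unfolding degree_grading_def using that by (intro span_base imageI) simp
  ultimately have "?L g \<noteq> {0}" if "g \<in> deg ` {1..n}" for g
    using that by fastforce
  moreover have "?L g = {0}" if "g \<notin> deg ` {1..n}" for g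
  proof -
    have "{j \<in> {1..n}. deg j = g} = {}" using that by blast
    then show ?thesis unfolding degree_grading_def by (simp only: image_empty span_empty)
  qed
  ultimately show ?thesis using deg unfolding grading_support_def by blast
qed

lemma degree_grading_abelian_group_grading:
  assumes A: "one_parametric_filiform scale mul n \<theta> e" and G: "comm_group G"
    and deg: "\<And>j. j \<in> {1..n} \<Longrightarrow> deg j \<in> carrier G"
    and gen: "carrier G \<subseteq> generate G (deg ` {1..n})"
    and m1: "\<And>i. 2 \<le> i \<Longrightarrow> i < n \<Longrightarrow> deg i \<otimes>\<^bsub>G\<^esub> deg 1 = deg (i + 1)"
    and m2: "2 \<le> n \<Longrightarrow> deg 1 \<otimes>\<^bsub>G\<^esub> deg 2 = deg n"
  shows "abelian_group_grading scale mul G (degree_grading scale n e deg)"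
proof -
  interpret G: comm_group G by fact
  have V: "vector_space scale" and B: "indexed_basis scale n e"
    using A by (auto simp: one_parametric_filiform_def complex_algebra_def)
  have "generate G (deg ` {1..n}) = carrier G"
    using gen G.generate_incl[of "deg ` {1..n}"] deg by blast
  moreover have "grading_support G (degree_grading scale n e deg) = deg ` {1..n}"
    using V B deg by (rule degree_grading_support)
  moreover have "direct_sum_decomposition scale (carrier G) (degree_grading scale n e deg)"
    using V B deg by (rule degree_grading_direct_sum)
  ultimately show ?thesis
    unfolding abelian_group_grading_def
    using G degree_grading_mult[where deg = deg and G = G, OF A m1 m2] by simp
qed

lemma one_parametric_filiform_leibniz:
  assumes A: "one_parametric_filiform scale mul n \<theta> e" and n: "n \<ge> 3"
  shows "leibniz_algebra scale mul"
proof -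
  have CA: "complex_algebra scale mul" and B: "indexed_basis scale n e"
    using A by (auto simp: one_parametric_filiform_def)
  interpret vector_space scale using CA by (simp add: complex_algebra_def)
  have sp: "span (e ` {1..n}) = UNIV" using B by (simp add: indexed_basis_def)
  have lin: "mul (a + b) c = mul a c + mul b c" "mul (scale k a) c = scale k (mul a c)"
    "mul c (a + b) = mul c a + mul c b" "mul c (scale k a) = scale k (mul c a)" for a b c k
    using CA by (auto simp: complex_algebra_def Vector_Spaces.linear_iff)
  have zero: "mul 0 c = 0" "mul c 0 = 0" for c
    using lin(2)[of 0 0 c] lin(4)[of c 0 0] by auto
  have p: "mul (e i) (e j) =
      (if 2 \<le> i \<and> i < n \<and> j = 1 then e (i + 1)
       else if i = 1 \<and> j = 2 then scale \<theta> (e n) else 0)"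
    if "i \<in> {1..n}" "j \<in> {1..n}" for i j
    using A that by (simp add: one_parametric_filiform_def)
  let ?P = "\<lambda>x y z. mul x (mul y z) = mul (mul x y) z - mul (mul x z) y"
  have left: "mul (e i) (mul (e j) (e k)) = 0"
    if "i \<in> {1..n}" "j \<in> {1..n}" "k \<in> {1..n}" for i j k
  proof -
    have "mul (e i) (e m) = 0" if "3 \<le> m" "m \<le> n" for m
      using p[of i m] \<open>i \<in> {1..n}\<close> that by simp
    then show ?thesis using p[of j k] that n by (simp add: lin zero)
  qed
  have right: "mul (mul (e i) (e j)) (e k) = (if 2 \<le> i \<and> i + 1 < n \<and> j = 1 \<and> k = 1 then e (i + 2) else 0)"
    if "i \<in> {1..n}" "j \<in> {1..n}" "k \<in> {1..n}" for i j k
  proof (cases "2 \<le> i \<and> i < n \<and> j = 1")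
    case True
    then show ?thesis using p[of i j] p[of "i + 1" k] that by simp
  next
    case False
    have "mul (e n) (e k) = 0" using p[of n k] that n by simp
    then show ?thesis using p[of i j] that False by (auto simp: lin zero)
  qed
  have step: "?P (e i) (e j) (e k)" if "i \<in> {1..n}" "j \<in> {1..n}" "k \<in> {1..n}" for i j k
    using left[of i j k] right[of i j k] right[of i k j] that by auto
  have 1: "?P (e i) (e j) z" if "i \<in> {1..n}" "j \<in> {1..n}" for i j z
  proof -
    have "z \<in> span (e ` {1..n})" by (simp only: sp UNIV_I)
    then show ?thesis
      by (induction z rule: span_induct)
         (use step that in \<open>auto intro!: subspaceI simp: lin zero scale_right_diff_distrib\<close>)
  qed
  have 2: "?P (e i) y z" if "i \<in> {1..n}" for i y z
  proof -
    have "y \<in> span (e ` {1..n})" by (simp only: sp UNIV_I)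
    then show ?thesis
      by (induction y rule: span_induct)
         (use 1 that in \<open>auto intro!: subspaceI simp: lin zero scale_right_diff_distrib\<close>)
  qed
  have "?P x y z" for x y z
  proof -
    have "x \<in> span (e ` {1..n})" by (simp only: sp UNIV_I)
    then show ?thesis
      by (induction x rule: span_induct)
         (use 2 in \<open>auto intro!: subspaceI simp: lin zero scale_right_diff_distrib\<close>)
  qed
  then show ?thesis using CA by (simp add: leibniz_algebra_def)
qed

lemma generate_integer_mod_group:
  assumes t: "t > 0" and S: "1 mod int t \<in> S"
  shows "carrier (integer_mod_group t) \<subseteq> generate (integer_mod_group t) S"
proof
  fix x assume x: "x \<in> carrier (integer_mod_group t)"
  have "int k mod int t \<in> generate (integer_mod_group t) S" for k
  proof (induction k)
    case 0
    show ?case using generate.one[of "integer_mod_group t" S] t by simp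
  next
    case (Suc k)
    have "int k mod int t \<otimes>\<^bsub>integer_mod_group t\<^esub> (1 mod int t) \<in> generate (integer_mod_group t) S"
      using Suc generate.incl[OF S] by (rule generate.eng)
    then show ?case by (simp add: mod_add_eq ac_simps)
  qed
  from this[of "nat x"] show "x \<in> generate (integer_mod_group t) S"
    using x t by (simp add: carrier_integer_mod_group)
qed

lemma gradingA:
  assumes "one_parametric_filiform scale mul n \<theta> e" and "n \<ge> 2"
  shows "abelian_group_grading scale mul (integer_mod_group 2) (degree_grading scale n e degA)"
proof (rule degree_grading_abelian_group_grading[OF assms(1)])
  have "1 mod int 2 \<in> degA ` {1..n}"
    using assms(2) by (intro image_eqI[of _ _ 2]) (auto simp: degA_def)
  then show "carrier (integer_mod_group 2) \<subseteq> generate (integer_mod_group 2) (degA ` {1..n})"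
    by (intro generate_integer_mod_group) auto
qed (use assms(2) in \<open>auto simp: degA_def carrier_integer_mod_group\<close>)

lemma degree_mod_t:
  assumes t: "t dvd n - 3" and n: "n \<ge> 4"
  shows "t > 0" and "(int n - 3) mod int t = 0"
proof -
  show "t > 0" using assms by (auto intro: Nat.gr0I)
  have "int t dvd int (n - 3)" using t by simp
  then show "(int n - 3) mod int t = 0" using n by (simp add: of_nat_diff)
qed

lemma gradingB:
  assumes A: "one_parametric_filiform scale mul n \<theta> e" and n: "n \<ge> 4" and t: "t dvd n - 3"
  shows "abelian_group_grading scale mul (integer_mod_group t) (degree_grading scale n e (degB t))"
proof (rule degree_grading_abelian_group_grading[OF A])
  note d = degree_mod_t[OF t n]
  have "1 mod int t \<in> degB t ` {1..n}"
    using n by (intro image_eqI[of _ _ 1]) (auto simp: degB_def)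
  then show "carrier (integer_mod_group t) \<subseteq> generate (integer_mod_group t) (degB t ` {1..n})"
    using d by (intro generate_integer_mod_group) auto
  have "(1 + 0) mod int t = (1 + (int n - 3)) mod int t"
    using d(2) by (metis mod_add_right_eq)
  then show "degB t 1 \<otimes>\<^bsub>integer_mod_group t\<^esub> degB t 2 = degB t n"
    using n by (auto simp: degB_def mod_simps)
  show "degB t i \<otimes>\<^bsub>integer_mod_group t\<^esub> degB t 1 = degB t (i + 1)" if "2 \<le> i" for i
    using that mod_add_eq[of "int i - 2" "int t" 1] by (simp add: degB_def algebra_simps)
qed (use degree_mod_t(1)[OF t n] in \<open>auto simp: degB_def carrier_integer_mod_group\<close>)

lemma gradingD:
  assumes A: "one_parametric_filiform scale mul n \<theta> e" and n: "n \<ge> 4" and t: "t dvd n - 3"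
  shows "abelian_group_grading scale mul (integer_mod_group t) (degree_grading scale n e (degD t \<tau>))"
proof (rule degree_grading_abelian_group_grading[OF A])
  note d = degree_mod_t[OF t n]
  have "1 mod int t \<in> degD t \<tau> ` {1..n}"
    using n by (intro image_eqI[of _ _ 1]) (auto simp: degD_def)
  then show "carrier (integer_mod_group t) \<subseteq> generate (integer_mod_group t) (degD t \<tau> ` {1..n})"
    using d by (intro generate_integer_mod_group) auto
  have "(- int \<tau> + 0) mod int t = (- int \<tau> + (int n - 3)) mod int t"
    using d(2) by (metis mod_add_right_eq)
  then show "degD t \<tau> 1 \<otimes>\<^bsub>integer_mod_group t\<^esub> degD t \<tau> 2 = degD t \<tau> n"
    using n by (auto simp: degD_def mod_simps algebra_simps)
  show "degD t \<tau> i \<otimes>\<^bsub>integer_mod_group t\<^esub> degD t \<tau> 1 = degD t \<tau> (i + 1)" if "2 \<le> i" for i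
    using that mod_add_eq[of "int i - 3 - int \<tau>" "int t" 1] by (simp add: degD_def algebra_simps)
qed (use degree_mod_t(1)[OF t n] in \<open>auto simp: degD_def carrier_integer_mod_group\<close>)

lemma gradingC:
  assumes A: "one_parametric_filiform scale mul n \<theta> e" and n: "n \<ge> 4" and t: "t dvd n - 3"
  shows "abelian_group_grading scale mul (integer_mod_group t \<times>\<times> integer_group)
           (degree_grading scale n e (degC t))"
proof (rule degree_grading_abelian_group_grading[OF A])
  let ?Z = "integer_mod_group t" let ?G = "?Z \<times>\<times> integer_group"
  let ?H = "generate ?G (degC t ` {1..n})"
  note d = degree_mod_t[OF t n]
  have one: "\<one>\<^bsub>?G\<^esub> = (0, 0)" by simp
  have gen: "(a, k) \<in> ?H" if "(a, k) = degC t j" "j \<in> {1..n}" for a k j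
    using that by (auto intro: generate.incl)
  have add: "((a + b) mod int t, k + l) \<in> ?H" if "(a, k) \<in> ?H" "(b, l) \<in> ?H" for a b k l
    using generate.eng[OF that] by simp
  have u: "(1 mod int t, 0) \<in> ?H" using gen[of _ _ 1] n by (simp add: degC_def)
  have u': "(int k mod int t, 0) \<in> ?H" for k
  proof (induction k)
    case 0
    show ?case using generate.one[of ?G] by simp
  next
    case (Suc k)
    show ?case using add[OF Suc u] by (simp add: mod_simps ac_simps)
  qed
  have v: "(0, 1) \<in> ?H" using gen[of _ _ 3] n by (simp add: degC_def)
  have w: "(0, -1) \<in> ?H"
  proof -
    have "inv\<^bsub>?G\<^esub> (0, 1) = (0, -1)"
      by (rule group.inv_equality) (use d in \<open>auto simp: DirProd_group carrier_integer_mod_group\<close>)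
    moreover have "(0, 1) \<in> degC t ` {1..n}"
      using n by (intro image_eqI[of _ _ 3]) (auto simp: degC_def)
    ultimately show ?thesis using generate.inv by metis
  qed
  have z: "(0, k) \<in> ?H" for k
  proof (induction k rule: int_induct[of _ 0])
    case base
    show ?case using u'[of 0] by simp
  next
    case (step1 i)
    show ?case using add[OF step1(2) v] by simp
  next
    case (step2 i)
    show ?case using add[OF step2(2) w] by simp
  qed
  show "carrier ?G \<subseteq> ?H"
  proof clarify
    fix a k assume "(a, k) \<in> carrier ?G"
    then have "int (nat a) mod int t = a" "a mod int t = a" using d by (auto simp: carrier_integer_mod_group)
    then show "(a, k) \<in> ?H" using add[OF u'[of "nat a"] z[of k]] by simp
  qed
  have "(1 mod int t + (int 2 - 3) mod int t) mod int t = (int n - 3) mod int t"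
    unfolding mod_add_eq using d by simp
  then show "degC t 1 \<otimes>\<^bsub>?G\<^esub> degC t 2 = degC t n"
    using n by (simp add: degC_def)
  show "comm_group ?G"
    by (intro group.group_comm_groupI DirProd_group)
       (auto simp: mult_integer_mod_group mult_integer_group add.commute)
  show "degC t i \<otimes>\<^bsub>?G\<^esub> degC t 1 = degC t (i + 1)" if "2 \<le> i" for i
    using that mod_add_eq[of "int i - 3" "int t" 1] by (simp add: degC_def algebra_simps)
qed (use degree_mod_t(1)[OF t n] in \<open>auto simp: degC_def carrier_integer_mod_group\<close>)

lemma trivial_grading_abelian_group_grading:
  fixes scale :: "complex \<Rightarrow> 'a::ab_group_add \<Rightarrow> 'a"
  assumes "vector_space scale" and G: "comm_group G" and c: "carrier G = {\<one>\<^bsub>G\<^esub>}"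
  shows "abelian_group_grading scale mul G (trivial_grading G)"
proof -
  interpret vector_space scale by fact
  interpret G: comm_group G by fact
  let ?T = "trivial_grading G :: _ \<Rightarrow> 'a set"
  have "grading_support G ?T \<subseteq> {\<one>\<^bsub>G\<^esub>}"
    using c by (auto simp: grading_support_def)
  then have "generate G (grading_support G ?T) = carrier G"
    using G.generate_incl[of "grading_support G ?T"] generate.one[of G] c by fastforce
  moreover have "x g = 0"
    if "F \<subseteq> {\<one>\<^bsub>G\<^esub>}" "(\<Sum>g\<in>F. x g) = 0" "g \<in> F" for F g and x :: "_ \<Rightarrow> 'a"
  proof -
    have "F = {g}" using that by auto
    then show ?thesis using that(2) by simp
  qed
  ultimately show ?thesis
    unfolding abelian_group_grading_def direct_sum_decomposition_def using G
    by (auto simp: c trivial_grading_def)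
qed

end

theory Submission
  imports Defs "HOL-Algebra.Multiplicative_Group"
begin

text \<open>
  The span of \<open>e\<^sub>2, \<dots>, e\<^sub>n\<close> is the right annihilator of a homogeneous element, hence graded, so there are
  homogeneous elements \<open>u = e\<^sub>1 + \<dots>\<close> of degree \<open>g\<close> and \<open>v\<close> of degree \<open>h\<close>, where \<open>v\<close> is a combination of
  \<open>e\<^sub>2, \<dots>, e\<^sub>n\<close> with nonzero coefficient at \<open>e\<^sub>2\<close>. Adding to \<open>u\<close> elements of degree \<open>g\<close> in this span
  makes \<open>u\<^sup>2 = 0\<close>; then \<open>e\<^sub>1 \<mapsto> u\<close>, \<open>e\<^sub>j \<mapsto> v R\<^sub>u\<^sup>j\<^sup>-\<^sup>2\<close> (with \<open>R\<^sub>u\<close> the right multiplication by \<open>u\<close>) is an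
  automorphism, so up to equivalence \<open>e\<^sub>1\<close> has degree \<open>g\<close> and \<open>e\<^sub>j\<close> has degree \<open>h + (j - 2)g\<close>. Comparing
  \<open>u v\<close> with \<open>e\<^sub>n\<close> gives \<open>(n - 3)g = 0\<close>. Only the coincidences among these degrees matter for equivalence,
  and they are determined by the order of \<open>g\<close> and by which multiple of \<open>g\<close>, if any, \<open>h\<close> is.
\<close>

section \<open>Homogeneous components of a graded algebra\<close>

locale graded_algebra = vector_space scale + comm_group G
  for scale :: "complex \<Rightarrow> 'a::ab_group_add \<Rightarrow> 'a" and G :: "('g, 'm) monoid_scheme" (structure) +
  fixes mul :: "'a \<Rightarrow> 'a \<Rightarrow> 'a" and L :: "'g \<Rightarrow> 'a set"
  assumes algebra: "complex_algebra scale mul"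
    and grading: "abelian_group_grading scale mul G L"
begin

lemma mul_add: "mul (a + b) c = mul a c + mul b c" "mul c (a + b) = mul c a + mul c b"
  and mul_scale: "mul (scale k a) c = scale k (mul a c)" "mul c (scale k a) = scale k (mul c a)"
  using algebra by (auto simp: complex_algebra_def Vector_Spaces.linear_iff)

lemma mul_zero [simp]: "mul 0 c = 0" "mul c 0 = 0"
  using mul_scale(1)[of 0 0 c] mul_scale(2)[of c 0 0] by auto

lemma mul_diff: "mul (a - b) c = mul a c - mul b c" "mul c (a - b) = mul c a - mul c b"
  using mul_add(1)[of "a - b" b c] mul_add(2)[of c "a - b" b] by (simp_all add: algebra_simps)

lemma subspace_component: "g \<in> carrier G \<Longrightarrow> subspace (L g)"
  and span_components: "span (\<Union>g\<in>carrier G. L g) = UNIV"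
  and mul_component: "g \<in> carrier G \<Longrightarrow> h \<in> carrier G \<Longrightarrow> x \<in> L g \<Longrightarrow> y \<in> L h \<Longrightarrow> mul x y \<in> L (g \<otimes> h)"
  and independent_components: "finite F \<Longrightarrow> F \<subseteq> carrier G \<Longrightarrow> (\<And>g. g \<in> F \<Longrightarrow> f g \<in> L g) \<Longrightarrow>
    (\<Sum>g\<in>F. f g) = 0 \<Longrightarrow> g \<in> F \<Longrightarrow> f g = 0"
  using grading unfolding abelian_group_grading_def direct_sum_decomposition_def by blast+

text \<open>The complement of \<open>L k\<close> along which vectors are projected to degree
  \<open>k\<close>.\<close>

definition others :: "'g \<Rightarrow> 'a set" where
  "others k = span (\<Union>g\<in>carrier G - {k}. L g)"

lemma subspace_others: "subspace (others k)"
  by (simp add: others_def)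

text \<open>Directness speaks of one vector per degree, so spanning vectors of equal degree are
  merged. The disjunct about the carrier is there because \<open>L\<close> is arbitrary outside
  it.\<close>

lemma span_components_sum:
  assumes "J \<subseteq> carrier G" and "x \<in> span (\<Union>g\<in>J. L g)"
  shows "\<exists>F f. finite F \<and> F \<subseteq> J \<and> (\<forall>g. f g \<in> L g \<or> g \<notin> carrier G) \<and> x = (\<Sum>g\<in>F. f g)"
  using assms(2)
proof (induction rule: span_induct_alt)
  case base
  show ?case using subspace_0[OF subspace_component] by (intro exI[of _ "{}"] exI[of _ "\<lambda>_. 0"]) auto
next
  case (step c a y)
  then obtain h F f where h: "h \<in> J" "a \<in> L h" and F: "finite F" "F \<subseteq> J"
    "\<forall>g. f g \<in> L g \<or> g \<notin> carrier G" "y = (\<Sum>g\<in>F. f g)" by blast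
  \<comment> \<open>\<open>f\<close> may be nonzero outside \<open>F\<close>, in particular at
    \<open>h\<close>, so it is cut off to \<open>F\<close> before the new term is added.\<close>
  define f' where "f' = (\<lambda>g. (if g = h then scale c a else 0) + (if g \<in> F then f g else 0))"
  have "f' g \<in> L g" if "g \<in> carrier G" for g
  proof -
    note s = subspace_component[OF that]
    have "f g \<in> L g" using F(3) that by blast
    then show ?thesis using h s subspace_0[OF s] unfolding f'_def
      by (intro subspace_add[OF s]) (auto intro: subspace_scale)
  qed
  moreover have "(\<Sum>g\<in>insert h F. f' g) = scale c a + y"
    unfolding f'_def F(4) using F(1)
    by (simp add: sum.distrib sum.delta sum.If_cases Int_absorb1 subset_insertI Int_insert_left insert_absorb)
  ultimately show ?case using F h
    by (intro exI[of _ "insert h F"] exI[of _ f']) auto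
qed

lemma component_inter_others:
  assumes k: "k \<in> carrier G" and x: "x \<in> L k" "x \<in> others k"
  shows "x = 0"
proof -
  obtain F f where F: "finite F" "F \<subseteq> carrier G - {k}" "\<forall>g. f g \<in> L g \<or> g \<notin> carrier G"
    "x = (\<Sum>g\<in>F. f g)"
    using span_components_sum[of "carrier G - {k}" x] x(2) unfolding others_def by blast
  \<comment> \<open>Placing \<open>- x\<close> in degree \<open>k\<close> gives a vanishing sum over
    distinct degrees, to which directness applies.\<close>
  define f' where "f' = (\<lambda>g. if g = k then - x else f g)"
  have "(\<Sum>g\<in>F. f' g) = x"
    unfolding F(4) f'_def using F(2) by (intro sum.cong) auto
  then have "(\<Sum>g\<in>insert k F. f' g) = 0"
    using F(1,2) by (subst sum.insert) (auto simp: f'_def)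
  then have "f' k = 0"
    by (rule independent_components[rotated 3])
       (use F k x(1) subspace_neg[OF subspace_component] in \<open>auto simp: f'_def\<close>)
  then show ?thesis by (simp add: f'_def)
qed

text \<open>For \<open>k\<close> in the carrier, the projection onto \<open>L k\<close> with kernel
  \<open>others k\<close>. With this characterization, identities for it reduce to
  \<open>part_unique\<close>.\<close>

definition part :: "'g \<Rightarrow> 'a \<Rightarrow> 'a" where
  "part k x = (THE y. y \<in> L k \<and> x - y \<in> others k)"

lemma part_unique:
  assumes k: "k \<in> carrier G" and y: "y \<in> L k" "x - y \<in> others k"
  shows "part k x = y"
  unfolding part_def
proof (rule the_equality)
  fix z assume z: "z \<in> L k \<and> x - z \<in> others k"
  have "z - y \<in> L k" using z y by (intro subspace_diff subspace_component k) auto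
  moreover have "(x - y) - (x - z) \<in> others k"
    using z y subspace_diff[OF subspace_others] by blast
  then have "z - y \<in> others k" by simp
  ultimately show "z = y" using component_inter_others[OF k] by fastforce
qed (use y in auto)

lemma part_exists:
  assumes k: "k \<in> carrier G"
  shows "\<exists>y. y \<in> L k \<and> x - y \<in> others k"
proof -
  have "x \<in> span (\<Union>g\<in>carrier G. L g)" by (simp only: span_components UNIV_I)
  then show ?thesis
  proof (induction x rule: span_induct_alt)
    case base
    show ?case using subspace_0[OF subspace_component[OF k]] subspace_0[OF subspace_others]
      by (intro exI[of _ 0]) auto
  next
    case (step c a y)
    then obtain g z where g: "g \<in> carrier G" "a \<in> L g" and z: "z \<in> L k" "y - z \<in> others k" by blast
    show ?case
    proof (cases "g = k")
      case True
      then show ?thesis using z g subspace_component[OF k]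
        by (intro exI[of _ "scale c a + z"]) (auto intro: subspace_add subspace_scale)
    next
      case False
      then have "scale c a \<in> others k"
        using g unfolding others_def by (intro span_scale span_base) auto
      from subspace_add[OF subspace_others this z(2)] show ?thesis
        using z(1) by (intro exI[of _ z]) (auto simp: algebra_simps)
    qed
  qed
qed

lemma part_in: "k \<in> carrier G \<Longrightarrow> part k x \<in> L k"
  and part_others: "k \<in> carrier G \<Longrightarrow> x - part k x \<in> others k"
  using part_exists part_unique by metis+

lemma part_same: "k \<in> carrier G \<Longrightarrow> x \<in> L k \<Longrightarrow> part k x = x"
  using subspace_0[OF subspace_others] by (intro part_unique) auto

lemma part_other:
  assumes "k \<in> carrier G" "g \<in> carrier G" "g \<noteq> k" "x \<in> L g"
  shows "part k x = 0"
proof (rule part_unique)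
  have "x \<in> others k" using assms unfolding others_def by (intro span_base) auto
  then show "x - 0 \<in> others k" by simp
qed (use assms subspace_0[OF subspace_component] in auto)

lemma part_add:
  assumes k: "k \<in> carrier G"
  shows "part k (x + y) = part k x + part k y"
proof (rule part_unique[OF k])
  have "(x - part k x) + (y - part k y) \<in> others k"
    by (intro subspace_add subspace_others part_others k)
  then show "x + y - (part k x + part k y) \<in> others k" by (simp add: algebra_simps)
qed (intro subspace_add subspace_component part_in k)

lemma part_scale:
  assumes k: "k \<in> carrier G"
  shows "part k (scale c x) = scale c (part k x)"
proof (rule part_unique[OF k])
  have "scale c (x - part k x) \<in> others k"
    by (intro subspace_scale subspace_others part_others k)
  then show "scale c x - scale c (part k x) \<in> others k" by (simp add: scale_right_diff_distrib)
qed (intro subspace_scale subspace_component part_in k)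

text \<open>Translation by \<open>g\<close> is injective on the group, so degrees other than
  \<open>k\<close> go to degrees other than the translate of \<open>k\<close>.\<close>

lemma mul_others:
  assumes "g \<in> carrier G" "k \<in> carrier G" "p \<in> L g" "x \<in> others k"
  shows "mul p x \<in> others (g \<otimes> k)" and "mul x p \<in> others (k \<otimes> g)"
proof -
  have *: "mul p a \<in> others (g \<otimes> k) \<and> mul a p \<in> others (k \<otimes> g)"
    if "h \<in> carrier G - {k}" "a \<in> L h" for a h
  proof -
    have "mul p a \<in> L (g \<otimes> h)" "mul a p \<in> L (h \<otimes> g)"
      using assms that by (auto intro: mul_component)
    moreover have "g \<otimes> h \<in> carrier G - {g \<otimes> k}" "h \<otimes> g \<in> carrier G - {k \<otimes> g}"
      using assms that by auto
    ultimately show ?thesis unfolding others_def by (blast intro: span_base)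
  qed
  have "mul p x \<in> others (g \<otimes> k) \<and> mul x p \<in> others (k \<otimes> g)"
    using assms(4) unfolding others_def[of k]
  proof (induction x rule: span_induct_alt)
    case base
    show ?case using subspace_0[OF subspace_others] by auto
  next
    case (step c a y)
    then have "mul p a \<in> others (g \<otimes> k) \<and> mul a p \<in> others (k \<otimes> g)" using * by blast
    then show ?case using step subspace_others
      by (auto simp: mul_add mul_scale intro!: subspace_add subspace_scale)
  qed
  then show "mul p x \<in> others (g \<otimes> k)" and "mul x p \<in> others (k \<otimes> g)" by auto
qed

text \<open>Multiplication by \<open>p\<close> carries the splitting of \<open>x\<close> along
  \<open>L k\<close> and \<open>others k\<close> to the splitting of the product. Equations between
  products can thus be projected to a single degree.\<close>

lemma part_mul:
  assumes "g \<in> carrier G" "k \<in> carrier G" "p \<in> L g"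
  shows "part (g \<otimes> k) (mul p x) = mul p (part k x)" and "part (k \<otimes> g) (mul x p) = mul (part k x) p"
proof -
  show "part (g \<otimes> k) (mul p x) = mul p (part k x)"
    using mul_others(1)[OF assms part_others] part_in mul_component assms
    by (intro part_unique) (auto simp: mul_diff)
  show "part (k \<otimes> g) (mul x p) = mul (part k x) p"
    using mul_others(2)[OF assms part_others] part_in mul_component assms
    by (intro part_unique) (auto simp: mul_diff)
qed

lemma sum_part: "\<exists>F. finite F \<and> F \<subseteq> carrier G \<and> x = (\<Sum>g\<in>F. part g x)"
proof -
  have "x \<in> span (\<Union>g\<in>carrier G. L g)" by (simp only: span_components UNIV_I)
  from span_components_sum[OF subset_refl this] obtain F f where F: "finite F" "F \<subseteq> carrier G"
    "\<forall>g. f g \<in> L g \<or> g \<notin> carrier G" "x = (\<Sum>g\<in>F. f g)" by blast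
  have "part g x = f g" if "g \<in> F" for g
  proof (rule part_unique)
    have "x - f g = (\<Sum>h\<in>F - {g}. f h)" using F(1,4) that by (simp add: sum_diff1)
    also have "\<dots> \<in> others g"
      unfolding others_def using F by (intro span_sum span_base) blast
    finally show "x - f g \<in> others g" .
  qed (use F that in auto)
  then have "(\<Sum>g\<in>F. part g x) = x" unfolding F(4) by (intro sum.cong refl)
  with F(1,2) show ?thesis by metis
qed

end

section \<open>Coordinates and automorphisms of the filiform algebra\<close>

locale filiform_algebra = vector_space scale
  for scale :: "complex \<Rightarrow> 'a::ab_group_add \<Rightarrow> 'a" +
  fixes mul :: "'a \<Rightarrow> 'a \<Rightarrow> 'a" and n :: nat and \<theta> :: complex and e :: "nat \<Rightarrow> 'a"
  assumes filiform: "one_parametric_filiform scale mul n \<theta> e" and n: "4 \<le> n" and theta: "\<theta> \<noteq> 0"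
begin

lemma basis_independent: "independent (e ` {1..n})"
  and basis_inj: "inj_on e {1..n}"
  and basis_span: "span (e ` {1..n}) = UNIV"
  using filiform by (auto simp: one_parametric_filiform_def indexed_basis_def)

lemma linear_mul: "Vector_Spaces.linear scale scale (\<lambda>y. mul x y)" "Vector_Spaces.linear scale scale (\<lambda>x. mul x y)"
  using filiform by (auto simp: one_parametric_filiform_def complex_algebra_def)

definition coord :: "nat \<Rightarrow> 'a \<Rightarrow> complex" where
  "coord i x = representation (e ` {1..n}) x (e i)"

lemma coord_add: "coord i (x + y) = coord i x + coord i y"
  and coord_diff: "coord i (x - y) = coord i x - coord i y"
  and coord_scale: "coord i (scale c x) = c * coord i x"
  and coord_zero [simp]: "coord i 0 = 0"
  using basis_independent basis_span
  by (auto simp: coord_def representation_add representation_diff representation_scale representation_zero)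

lemma coord_sum: "coord i (\<Sum>j\<in>S. f j) = (\<Sum>j\<in>S. coord i (f j))"
  by (induction S rule: infinite_finite_induct) (auto simp: coord_add)

lemma coord_basis: "i \<in> {1..n} \<Longrightarrow> j \<in> {1..n} \<Longrightarrow> coord i (e j) = (if i = j then 1 else 0)"
  using representation_basis[OF basis_independent, of "e j"] inj_on_eq_iff[OF basis_inj, of i j]
  by (simp add: coord_def)

lemma sum_coord: "(\<Sum>i\<in>{1..n}. scale (coord i x) (e i)) = x"
proof -
  have "(\<Sum>b\<in>e ` {1..n}. scale (representation (e ` {1..n}) x b) b) = x"
    using basis_independent basis_span by (intro sum_representation_eq) auto
  then show ?thesis unfolding sum.reindex[OF basis_inj] by (simp only: coord_def o_def)
qed

lemma coord_eqI: "(\<And>i. i \<in> {1..n} \<Longrightarrow> coord i x = coord i y) \<Longrightarrow> x = y"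
  by (metis (no_types, lifting) sum.cong sum_coord)

text \<open>By bilinearity basis vectors suffice: \<open>e j\<close> arises only from
  \<open>e (j - 1)\<close> times \<open>e 1\<close> with \<open>j - 1\<close> at least 2 and, if
  \<open>j = n\<close>, from \<open>e 1\<close> times \<open>e 2\<close>. The attribute puts the
  right-hand side in the \<open>Suc 0\<close> form that the simplifier uses.\<close>

lemma coord_mul [unfolded One_nat_def]:
  assumes "j \<in> {1..n}"
  shows "coord j (mul x y) =
    (if 3 \<le> j then coord (j - 1) x * coord 1 y else 0) + (if j = n then \<theta> * coord 1 x * coord 2 y else 0)"
    (is "_ = ?R x y")
proof -
  have p: "mul (e i) (e k) =
      (if 2 \<le> i \<and> i < n \<and> k = 1 then e (i + 1)
       else if i = 1 \<and> k = 2 then scale \<theta> (e n) else 0)"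
    if "i \<in> {1..n}" "k \<in> {1..n}" for i k
    using filiform that by (simp add: one_parametric_filiform_def)
  have z: "mul 0 y = 0" "mul x 0 = 0" for x y
    using linear_mul by (metis Vector_Spaces.linear_iff scale_zero_left)+
  have b: "coord j (mul (e i) (e k)) = ?R (e i) (e k)" if "i \<in> {1..n}" "k \<in> {1..n}" for i k
  proof -
    have "coord (j - 1) (e i) = (if j - 1 = i then 1 else 0)" if "3 \<le> j"
      using that assms \<open>i \<in> {1..n}\<close> by (intro coord_basis) auto
    then show ?thesis using p[OF that] that assms n by (auto simp: coord_basis coord_scale)
  qed
  have 1: "coord j (mul (e i) y) = ?R (e i) y" if i: "i \<in> {1..n}" for i y
  proof -
    have "y \<in> span (e ` {1..n})" by (simp only: basis_span UNIV_I)
    then show ?thesis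
    proof (induction y rule: span_induct_alt)
      case (step c a y)
      then obtain k where "k \<in> {1..n}" "a = e k" by blast
      from b[OF i this(1)] this(2) step(2) linear_mul(1)[of "e i"] show ?case
        by (simp add: Vector_Spaces.linear_iff coord_add coord_scale algebra_simps)
    qed (simp add: z)
  qed
  have "x \<in> span (e ` {1..n})" by (simp only: basis_span UNIV_I)
  then show ?thesis
  proof (induction x rule: span_induct_alt)
    case (step c a x)
    then obtain k where "k \<in> {1..n}" "a = e k" by blast
    from 1[OF this(1), of y] this(2) step(2) linear_mul(2)[of y] show ?case
      by (simp add: Vector_Spaces.linear_iff coord_add coord_scale algebra_simps)
  qed (simp add: z)
qed

lemma coord_mul_low [simp]: "coord 1 (mul x y) = 0" "coord (Suc 0) (mul x y) = 0" "coord 2 (mul x y) = 0"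
  using n by (simp_all add: coord_mul)

definition extension :: "(nat \<Rightarrow> 'a) \<Rightarrow> 'a \<Rightarrow> 'a" where
  "extension b x = (\<Sum>i\<in>{1..n}. scale (coord i x) (b i))"

lemma linear_extension: "Vector_Spaces.linear scale scale (extension b)"
  by (auto simp: Vector_Spaces.linear_iff vector_space_axioms extension_def coord_add coord_scale
      scale_left_distrib sum.distrib scale_sum_right)

lemma extension_basis:
  assumes "i \<in> {1..n}"
  shows "extension b (e i) = b i"
proof -
  have "extension b (e i) = (\<Sum>k\<in>{1..n}. if k = i then b i else 0)"
    unfolding extension_def using assms by (intro sum.cong) (auto simp: coord_basis)
  then show ?thesis using assms by simp
qed

lemma linear_eqI:
  assumes "Vector_Spaces.linear scale scale f" "Vector_Spaces.linear scale scale g"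
    and "\<And>i. i \<in> {1..n} \<Longrightarrow> f (e i) = g (e i)"
  shows "f x = g x"
proof -
  interpret vector_space_pair scale scale by unfold_locales
  show ?thesis
    by (rule linear_eq_on[OF assms(1,2), of x "e ` {1..n}"]) (use assms(3) basis_span in auto)
qed

text \<open>The matrix of the map is lower triangular with nonzero diagonal. Forward substitution
  shows that the kernel is zero; finite dimension then gives surjectivity.\<close>

lemma bij_extension_triangular:
  assumes lower: "\<And>i k. i \<in> {1..n} \<Longrightarrow> k \<in> {1..n} \<Longrightarrow> i < k \<Longrightarrow> coord i (b k) = 0"
    and diag: "\<And>k. k \<in> {1..n} \<Longrightarrow> coord k (b k) \<noteq> 0"
  shows "bij (extension b)"
proof -
  interpret finite_dimensional_vector_space scale "e ` {1..n}"
    by unfold_locales (use basis_independent basis_span in auto)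
  interpret Vector_Spaces.linear scale scale "extension b" by (rule linear_extension)
  have "x = 0" if x: "extension b x = 0" for x
  proof (rule coord_eqI)
    fix i assume "i \<in> {1..n}"
    then have "coord i x = 0"
    proof (induction i rule: less_induct)
      case (less i)
      have "0 = coord i (extension b x)" using x by simp
      also have "\<dots> = (\<Sum>k\<in>{1..n}. coord k x * coord i (b k))"
        by (simp add: extension_def coord_sum coord_scale)
      also have "\<dots> = (\<Sum>k\<in>{1..n}. if k = i then coord i x * coord i (b i) else 0)"
      proof (intro sum.cong refl)
        fix k assume k: "k \<in> {1..n}"
        consider "k < i" | "k = i" | "i < k" by linarith
        then show "coord k x * coord i (b k) = (if k = i then coord i x * coord i (b i) else 0)"
        proof cases
          case 1
          then show ?thesis using less.IH[of k] k by simp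
        next
          case 3
          then show ?thesis using lower[of i k] less.prems k by simp
        qed simp
      qed
      also have "\<dots> = coord i x * coord i (b i)" using less by simp
      finally show ?case using diag less by simp
    qed
    then show "coord i x = coord i 0" by simp
  qed
  then have "inj (extension b)" by (simp add: inj_iff_eq_0)
  moreover have "surj (extension b)"
    by (rule linear_inj_imp_surj[OF linear_extension \<open>inj (extension b)\<close>])
  ultimately show ?thesis by (simp add: bij_def)
qed

text \<open>Multiplicativity compares two bilinear maps, so \<open>linear_eqI\<close>, applied once
  per argument, reduces it to the multiplication table.\<close>

lemma automorphism_extension:
  assumes bij: "bij (extension b)"
    and prod: "\<And>i j. i \<in> {1..n} \<Longrightarrow> j \<in> {1..n} \<Longrightarrow> mul (b i) (b j) =
      (if 2 \<le> i \<and> i < n \<and> j = 1 then b (i + 1)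
       else if i = 1 \<and> j = 2 then scale \<theta> (b n) else 0)"
  shows "algebra_automorphism scale mul (extension b)"
proof -
  let ?f = "extension b"
  note f = linear_extension[of b]
  have add: "?f (x + y) = ?f x + ?f y" "mul (x + y) z = mul x z + mul y z" "mul z (x + y) = mul z x + mul z y"
    and scale: "?f (scale c x) = scale c (?f x)" "mul (scale c x) z = scale c (mul x z)"
      "mul z (scale c x) = scale c (mul z x)" for x y z c
    using f linear_mul unfolding Vector_Spaces.linear_iff by blast+
  have lin: "Vector_Spaces.linear scale scale (\<lambda>y. ?f (mul x y))"
    "Vector_Spaces.linear scale scale (\<lambda>y. mul (?f x) (?f y))"
    "Vector_Spaces.linear scale scale (\<lambda>x. ?f (mul x y))"
    "Vector_Spaces.linear scale scale (\<lambda>x. mul (?f x) (?f y))" for x y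
    unfolding Vector_Spaces.linear_iff using vector_space_axioms by (simp_all add: add scale)
  have f0: "?f 0 = 0" by (simp add: extension_def)
  have b: "?f (mul (e i) (e j)) = mul (?f (e i)) (?f (e j))" if "i \<in> {1..n}" "j \<in> {1..n}" for i j
  proof -
    have "mul (e i) (e j) =
      (if 2 \<le> i \<and> i < n \<and> j = 1 then e (i + 1)
       else if i = 1 \<and> j = 2 then scale \<theta> (e n) else 0)"
      using filiform that by (simp add: one_parametric_filiform_def)
    then show ?thesis
      using prod[OF that] that n by (auto simp: extension_basis f0 scale)
  qed
  have "?f (mul (e i) y) = mul (?f (e i)) (?f y)" if "i \<in> {1..n}" for i y
    by (rule linear_eqI[OF lin(1,2)]) (rule b[OF that])
  then have "?f (mul x y) = mul (?f x) (?f y)" for x y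
    by (rule linear_eqI[OF lin(3,4)])
  then show ?thesis using bij f by (simp add: algebra_automorphism_def)
qed

end

section \<open>Homogeneous generators and the normal form of a grading\<close>

locale graded_filiform = filiform_algebra scale mul n \<theta> e + graded_algebra scale G mul L
  for scale :: "complex \<Rightarrow> 'a::ab_group_add \<Rightarrow> 'a" and mul :: "'a \<Rightarrow> 'a \<Rightarrow> 'a"
    and n :: nat and \<theta> :: complex and e :: "nat \<Rightarrow> 'a"
    and G :: "('g, 'm) monoid_scheme" (structure) and L :: "'g \<Rightarrow> 'a set"
begin

text \<open>Otherwise the coordinate would vanish on all parts of \<open>e i\<close>, hence on their
  sum.\<close>

lemma homogeneous_coord:
  assumes i: "i \<in> {1..n}"
  obtains g x where "g \<in> carrier G" "x \<in> L g" "coord i x \<noteq> 0"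
proof -
  have False if "\<And>g x. g \<in> carrier G \<Longrightarrow> x \<in> L g \<Longrightarrow> coord i x = 0"
  proof -
    obtain F where "F \<subseteq> carrier G" "e i = (\<Sum>g\<in>F. part g (e i))" using sum_part by blast
    then have "coord i (e i) = (\<Sum>g\<in>F. coord i (part g (e i)))" by (metis coord_sum)
    also have "\<dots> = 0" using that part_in \<open>F \<subseteq> carrier G\<close> by (intro sum.neutral) blast
    finally show False using i by (simp add: coord_basis)
  qed
  then show ?thesis using that by blast
qed

text \<open>The hyperplane \<open>coord 1 x = 0\<close> is graded, being the right annihilator of a homogeneous element.\<close>

lemma part_hyperplane:
  assumes k: "k \<in> carrier G" and x: "coord 1 x = 0"
  shows "coord 1 (part k x) = 0"
proof -
  obtain g u where g: "g \<in> carrier G" and u: "u \<in> L g" "coord 1 u \<noteq> 0"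
    using homogeneous_coord[of 1] n by auto
  obtain h q where h: "h \<in> carrier G" and q: "q \<in> L h" "coord 2 q \<noteq> 0"
    using homogeneous_coord[of 2] n by auto
  \<comment> \<open>As \<open>3 < n\<close>, coordinate 3 of \<open>p\<close> is
    \<open>coord 2 q * coord 1 u\<close>. Since \<open>coord 1 p = 0\<close>, coordinate 4 of
    \<open>mul p y\<close> is \<open>coord 3 p * coord 1 y\<close>, so the right annihilator of
    \<open>p\<close> is exactly the hyperplane.\<close>
  define p where "p = mul q u"
  have p: "p \<in> L (h \<otimes> g)" "coord 1 p = 0" "coord 2 p = 0" "coord 3 p \<noteq> 0"
    using mul_component g h u q n by (simp_all add: p_def coord_mul)
  have "mul p x = 0"
    by (rule coord_eqI) (use p x n in \<open>simp add: coord_mul\<close>)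
  then have "mul p (part k x) = part (h \<otimes> g \<otimes> k) 0"
    using part_mul(1)[OF _ k p(1), of x] g h by simp
  also have "\<dots> = 0"
    using part_same[OF _ subspace_0[OF subspace_component]] g h k by simp
  finally have "coord 4 (mul p (part k x)) = 0" by simp
  then show ?thesis using p n by (simp add: coord_mul split: if_splits)
qed

text \<open>The parts of \<open>e 2\<close> stay in the hyperplane and add up to a vector with
  coordinate 2 equal to 1, so one of them qualifies.\<close>

lemma homogeneous_second:
  obtains h v where "h \<in> carrier G" "v \<in> L h" "coord 1 v = 0" "coord 2 v \<noteq> 0"
proof -
  have False if "\<And>g x. g \<in> carrier G \<Longrightarrow> x \<in> L g \<Longrightarrow> coord 1 x = 0 \<Longrightarrow> coord 2 x = 0"
  proof -
    obtain F where F: "F \<subseteq> carrier G" "e 2 = (\<Sum>g\<in>F. part g (e 2))" using sum_part by blast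
    then have "coord 2 (e 2) = (\<Sum>g\<in>F. coord 2 (part g (e 2)))" by (metis coord_sum)
    also have "\<dots> = 0"
    proof (intro sum.neutral ballI)
      fix g assume "g \<in> F"
      then have g: "g \<in> carrier G" using F by blast
      have "coord 1 (e 2) = 0" using n by (subst coord_basis) auto
      then show "coord 2 (part g (e 2)) = 0"
        by (intro that[OF g part_in[OF g]] part_hyperplane[OF g])
    qed
    finally show False using n by (simp add: coord_basis)
  qed
  then show ?thesis using that by blast
qed

lemma mul_hyperplane: "coord 1 x = 0 \<Longrightarrow> coord 1 y = 0 \<Longrightarrow> mul x y = 0"
  by (rule coord_eqI) (simp add: coord_mul)

text \<open>On the hyperplane, right multiplication by \<open>u\<close> shifts coordinates to the
  next index, so \<open>mul w u = x\<close> is solvable. The part of degree \<open>g\<close> of a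
  solution is again a solution, as \<open>x\<close> is homogeneous of degree
  \<open>g \<otimes> g\<close>.\<close>

lemma homogeneous_quotient:
  assumes g: "g \<in> carrier G" and u: "u \<in> L g" "coord 1 u = 1"
    and x: "x \<in> L (g \<otimes> g)" "coord 1 x = 0" "coord 2 x = 0"
  shows "\<exists>w. w \<in> L g \<and> coord 1 w = 0 \<and> mul w u = x \<and> coord 2 w = coord 3 x"
proof -
  \<comment> \<open>The coordinates of \<open>x\<close> are moved down by one index. The product
    \<open>mul (e n) u\<close> is zero, and the coefficient of \<open>e n\<close> is taken to be
    0.\<close>
  define w0 where "w0 = (\<Sum>i\<in>{2..n-1}. scale (coord (i + 1) x) (e i))"
  have w0: "coord j w0 = (if 2 \<le> j \<and> j \<le> n - 1 then coord (j + 1) x else 0)" if "j \<in> {1..n}" for j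
  proof -
    have "coord j w0 = (\<Sum>i\<in>{2..n-1}. if i = j then coord (j + 1) x else 0)"
      unfolding w0_def coord_sum coord_scale using that n
      by (intro sum.cong) (auto simp: coord_basis)
    then show ?thesis by simp
  qed
  have w0u: "mul w0 u = x"
  proof (rule coord_eqI)
    fix i assume i: "i \<in> {1..n}"
    then consider "i = 1" | "i = 2" | "3 \<le> i" by fastforce
    then show "coord i (mul w0 u) = coord i x"
    proof cases
      case 3
      then obtain j where "i = Suc j" "2 \<le> j" by (cases i) auto
      then have "coord (i - 1) w0 = coord i x" using w0[of j] i by auto
      then show ?thesis using 3 i n u w0[of 1] by (simp add: coord_mul)
    qed (use x in auto)
  qed
  let ?w = "part g w0"
  have 1: "coord 1 ?w = 0" using part_hyperplane[OF g] w0[of 1] n by simp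
  have 2: "mul ?w u = x"
    using part_mul(2)[OF g g u(1), of w0] w0u part_same[OF _ x(1)] g by simp
  have "coord 3 (mul ?w u) = coord 2 ?w" using 1 u n by (simp add: coord_mul)
  then show ?thesis using part_in[OF g] 1 2 by (intro exI[of _ ?w]) simp
qed

lemma homogeneous_square_zero:
  obtains g u where "g \<in> carrier G" "u \<in> L g" "coord 1 u = 1" "mul u u = 0"
proof -
  obtain g u0 where g: "g \<in> carrier G" and u0: "u0 \<in> L g" "coord 1 u0 \<noteq> 0"
    using homogeneous_coord[of 1] n by auto
  note S = subspace_component[OF g]
  define u where "u = scale (1 / coord 1 u0) u0"
  have u: "u \<in> L g" "coord 1 u = 1"
    using u0 subspace_scale[OF S] by (auto simp: u_def coord_scale)
  txt \<open>Subtracting \<open>w\<close> leaves the square \<open>- u w\<close>, a multiple of \<open>e n\<close>, which \<open>z\<close> cancels.\<close>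
  obtain w where w: "w \<in> L g" "coord 1 w = 0" "mul w u = mul u u"
    using homogeneous_quotient[OF g u mul_component[OF g g u(1) u(1)] coord_mul_low(1,3)] by blast
  obtain z where z: "z \<in> L g" "coord 1 z = 0" "mul z u = mul u w" "coord 2 z = coord 3 (mul u w)"
    using homogeneous_quotient[OF g u mul_component[OF g g u(1) w(1)] coord_mul_low(1,3)] by blast
  \<comment> \<open>Because \<open>3 < n\<close>, coordinate 3 of \<open>mul u w\<close> has no
    \<theta> term and vanishes with \<open>coord 1 w\<close>. So adding \<open>z\<close> creates no
    new product \<open>mul u z\<close>.\<close>
  have "coord 2 z = 0" using z(4) w n by (simp add: coord_mul)
  then have "mul u z = 0" using z by (intro coord_eqI) (simp add: coord_mul)
  moreover have "mul w w = 0" "mul w z = 0" "mul z w = 0" "mul z z = 0"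
    using w z by (simp_all add: mul_hyperplane)
  ultimately have "mul (u - w + z) (u - w + z) = 0"
    using w(3) z(3) by (simp add: mul_add mul_diff)
  moreover have "u - w + z \<in> L g" using u w z by (intro subspace_add subspace_diff S)
  moreover have "coord 1 (u - w + z) = 1" using u w z by (simp add: coord_add coord_diff)
  ultimately show ?thesis using that g by blast
qed

lemma canonical_form:
  obtains g h \<phi> where "g \<in> carrier G" "h \<in> carrier G" "g [^] (n - 3) = \<one>"
    "algebra_automorphism scale mul \<phi>"
    "\<And>k. k \<in> carrier G \<Longrightarrow> L k = \<phi> ` degree_grading scale n e (\<lambda>j. if j = 1 then g else h \<otimes> g [^] (j - 2)) k"
proof -
  obtain g u where g: "g \<in> carrier G" and u: "u \<in> L g" "coord 1 u = 1" "mul u u = 0"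
    using homogeneous_square_zero .
  obtain h v where h: "h \<in> carrier G" and v: "v \<in> L h" "coord 1 v = 0" "coord 2 v \<noteq> 0"
    using homogeneous_second .
  define R where "R k = ((\<lambda>x. mul x u) ^^ k) v" for k
  \<comment> \<open>Each factor \<open>u\<close> moves the coordinates up by one index; no \<theta>
    term arises, since \<open>coord 1 (R k) = 0\<close>.\<close>
  have coord_R: "coord i (R k) = (if k + 2 \<le> i then coord (i - k) v else 0)" if "i \<in> {1..n}" for i k
    using that
  proof (induction k arbitrary: i)
    case 0
    then have "i = 1" if "\<not> 2 \<le> i" using that by auto
    then show ?case using v(2) by (auto simp: R_def)
  next
    case (Suc k)
    have 1: "coord 1 (R k) = 0" using Suc.IH[of 1] n by simp
    have "coord i (R (Suc k)) = (if 3 \<le> i then coord (i - 1) (R k) else 0)"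
      using Suc.prems 1 u(2) by (simp add: R_def coord_mul)
    then show ?case using Suc.IH[of "i - 1"] Suc.prems by (cases i) auto
  qed
  define b where "b j = (if j = 1 then u else R (j - 2))" for j
  define d where "d j = (if j = 1 then g else h \<otimes> g [^] (j - 2))" for j :: nat
  have d: "d j \<in> carrier G" for j using g h by (simp add: d_def)
  have R_in: "R k \<in> L (h \<otimes> g [^] k)" for k
  proof (induction k)
    case 0
    show ?case using v h by (simp add: R_def)
  next
    case (Suc k)
    have "mul (R k) u \<in> L (h \<otimes> g [^] k \<otimes> g)" using Suc u g h by (intro mul_component) auto
    then show ?case using g h by (simp add: R_def m_assoc)
  qed
  have b_in: "b j \<in> L (d j)" for j using u R_in by (simp add: b_def d_def)
  have coord_b: "coord i (b k) = (if k \<le> i then coord (i - (k - 2)) v else 0)"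
    if "i \<in> {1..n}" "2 \<le> k" for i k
    using coord_R[OF that(1), of "k - 2"] that(2) by (auto simp: b_def)
  have b1: "coord 1 (b k) = 0" if "2 \<le> k" for k using coord_b[of 1 k] that n by simp
  \<comment> \<open>From \<open>k = n\<close> on, all coordinates of \<open>b k\<close> with index
    below \<open>n\<close> vanish, and the remaining one is shifted off the end.\<close>
  have bu: "mul (b k) u = (if k < n then b (k + 1) else 0)" if "2 \<le> k" for k
  proof (cases "k < n")
    case True
    obtain m where "k = Suc (Suc m)" using le_Suc_ex[OF \<open>2 \<le> k\<close>] by auto
    then show ?thesis using True by (simp add: b_def R_def)
  next
    case False
    have "mul (b k) u = 0"
    proof (rule coord_eqI)
      fix i assume i: "i \<in> {1..n}"
      have "coord (i - 1) (b k) = 0" if "3 \<le> i"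
        using coord_b[of "i - 1" k] \<open>2 \<le> k\<close> that i False by (cases i) auto
      then show "coord i (mul (b k) u) = coord i 0"
        using i u b1[OF that] by (auto simp: coord_mul)
    qed
    then show ?thesis using False by simp
  qed
  \<comment> \<open>Only the \<theta> term survives. Its factor \<open>coord 2 v\<close> is also the
    coefficient of \<open>e n\<close> in \<open>b n\<close>, so any value of it is compatible with
    \<theta>.\<close>
  have ub: "mul u (b k) = (if k = 2 then scale \<theta> (b n) else 0)" if "2 \<le> k" for k
  proof (rule coord_eqI)
    fix i assume i: "i \<in> {1..n}"
    have 2: "coord 2 (b k) = (if k = 2 then coord 2 v else 0)"
      using coord_b[of 2 k] that n by auto
    have "n - (n - 2) = 2" using n by simp
    then have "coord i (b n) = (if i = n then coord 2 v else 0)"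
      using coord_b[of i n] i n by auto
    then show "coord i (mul u (b k)) = coord i (if k = 2 then scale \<theta> (b n) else 0)"
      using i u(2) 2 b1[OF that] by (auto simp: coord_mul coord_scale)
  qed
  have prod: "mul (b i) (b j) =
      (if 2 \<le> i \<and> i < n \<and> j = 1 then b (i + 1)
       else if i = 1 \<and> j = 2 then scale \<theta> (b n) else 0)"
    if ij: "i \<in> {1..n}" "j \<in> {1..n}" for i j
  proof -
    have [simp]: "b 1 = u" "b (Suc 0) = u" by (simp_all add: b_def)
    consider "i = 1" "j = 1" | "i = 1" "2 \<le> j" | "2 \<le> i" "j = 1" | "2 \<le> i" "2 \<le> j"
      using ij by fastforce
    then show ?thesis
    proof cases
      case 1
      then show ?thesis using u(3) by simp
    next
      case 2
      then show ?thesis using ub[of j] by simp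
    next
      case 3
      then show ?thesis using bu[of i] by simp
    next
      case 4
      then show ?thesis using mul_hyperplane[OF b1 b1, of i j] by simp
    qed
  qed
  let ?f = "extension b"
  have bij: "bij ?f"
  proof (rule bij_extension_triangular)
    fix i k assume *: "i \<in> {1..n}" "k \<in> {1..n}" "i < k"
    then show "coord i (b k) = 0" using coord_b[of i k] by auto
  next
    fix k assume k: "k \<in> {1..n}"
    show "coord k (b k) \<noteq> 0"
    proof (cases "k = 1")
      case True
      then show ?thesis using u by (simp add: b_def)
    next
      case False
      then have "2 \<le> k" "k - (k - 2) = 2" using k by auto
      then show ?thesis using coord_b[OF k] v by simp
    qed
  qed
  have aut: "algebra_automorphism scale mul ?f"
    by (rule automorphism_extension[OF bij prod])
  have L: "L k = ?f ` degree_grading scale n e d k" if k: "k \<in> carrier G" for k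
  proof -
    interpret Vector_Spaces.linear scale scale ?f by (rule linear_extension)
    let ?M = "span (b ` {j \<in> {1..n}. d j = k})"
    have fe: "?f ` e ` {j \<in> {1..n}. d j = k} = b ` {j \<in> {1..n}. d j = k}"
      unfolding image_image by (intro image_cong refl) (simp add: extension_basis)
    then have M: "?f ` degree_grading scale n e d k = ?M"
      unfolding degree_grading_def by (simp only: span_image[symmetric] fe)
    have "?M \<subseteq> L k"
      using b_in by (intro span_minimal subspace_component k) auto
    \<comment> \<open>Projection to degree \<open>k\<close> keeps the \<open>b i\<close> of degree
      \<open>k\<close> and kills the others. As it is the identity on \<open>L k\<close>, this gives
      the reverse inclusion.\<close>
    moreover have "part k (?f y) \<in> ?M" for y
      unfolding extension_def
    proof -
      have c0: "part k 0 = 0" using part_scale[OF k, of 0 0] by simp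
      have cs: "part k (\<Sum>i\<in>S. f i) = (\<Sum>i\<in>S. part k (f i))" if "finite S" for f and S :: "nat set"
        using that by (induction S rule: finite_induct) (auto simp: c0 part_add[OF k])
      have "part k (b i) \<in> ?M" if "i \<in> {1..n}" for i
      proof (cases "d i = k")
        case True
        then show ?thesis using part_same[OF k] b_in[of i] that by (auto intro!: span_base)
      next
        case False
        then show ?thesis using part_other[OF k d _ b_in] by (simp add: span_zero)
      qed
      then show "part k (\<Sum>i\<in>{1..n}. scale (coord i y) (b i)) \<in> ?M"
        by (auto simp: cs part_scale[OF k] intro!: span_sum span_scale)
    qed
    then have "x \<in> ?M" if "x \<in> L k" for x
      using surjD[OF bij_is_surj[OF bij], of x] part_same[OF k that] by metis
    then have "L k \<subseteq> ?M" by blast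
    ultimately show ?thesis using M by simp
  qed
  have "g [^] (n - 3) = \<one>"
  proof -
    have "b n \<noteq> 0"
    proof
      assume "b n = 0"
      then have "?f (e n) = ?f 0" using n by (simp add: extension_basis) (simp add: extension_def)
      then have "e n = 0" by (rule injD[OF bij_is_inj[OF bij]])
      then show False using coord_basis[of n n] n by simp
    qed
    then have nz: "scale \<theta> (b n) \<noteq> 0" using theta by simp
    \<comment> \<open>A nonzero vector lying in the components of degrees \<open>d n\<close> and
      \<open>g \<otimes> d 2\<close> forces these degrees to be equal.\<close>
    have "scale \<theta> (b n) \<in> L (d n)" using b_in by (intro subspace_scale subspace_component d)
    moreover have "mul u (b 2) \<in> L (g \<otimes> d 2)" using u b_in g d by (intro mul_component) auto
    then have "scale \<theta> (b n) \<in> L (g \<otimes> d 2)" using ub by simp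
    ultimately have "g \<otimes> d 2 = d n"
      using part_other[of "d n" "g \<otimes> d 2"] part_same[of "d n"] nz d g by force
    moreover have "n - 2 = Suc (n - 3)" using n by simp
    \<comment> \<open>The factor \<open>\<one>\<close> lets cancellation of
      \<open>h \<otimes> g\<close> yield the claim; \<open>r_one\<close> is disabled to keep
      it.\<close>
    ultimately have "h \<otimes> g \<otimes> \<one> = h \<otimes> g \<otimes> g [^] (n - 3)"
      using g h n by (simp add: d_def m_ac)
    then show ?thesis using g h by (simp del: r_one)
  qed
  then show ?thesis using that[OF g h _ aut] L unfolding d_def by blast
qed

section \<open>Equivalence and the case distinction on degrees\<close>

text \<open>Equivalence asks for a bijection of supports, not for a group homomorphism, so it is
  enough that \<open>d\<close> and \<open>d'\<close> induce the same partition of the indices. As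
  \<phi> leads from the model to \<open>L\<close>, its inverse is the required automorphism.\<close>

lemma equivalent_to_degree_grading:
  assumes aut: "algebra_automorphism scale mul \<phi>"
    and L: "\<And>k. k \<in> carrier G \<Longrightarrow> L k = \<phi> ` degree_grading scale n e d k"
    and d: "\<And>j. j \<in> {1..n} \<Longrightarrow> d j \<in> carrier G"
    and H: "abelian_group_grading scale mul H (degree_grading scale n e d')"
    and d': "\<And>j. j \<in> {1..n} \<Longrightarrow> d' j \<in> carrier H"
    and same: "\<And>i j. i \<in> {1..n} \<Longrightarrow> j \<in> {1..n} \<Longrightarrow> d i = d j \<longleftrightarrow> d' i = d' j"
  shows "equivalent_gradings scale mul G L H (degree_grading scale n e d')"
proof -
  have bij: "bij \<phi>" and lin: "Vector_Spaces.linear scale scale \<phi>"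
    and mult: "\<And>x y. \<phi> (mul x y) = mul (\<phi> x) (\<phi> y)"
    using aut by (auto simp: algebra_automorphism_def)
  have inv: "inv_into UNIV \<phi> (\<phi> x) = x" "\<phi> (inv_into UNIV \<phi> x) = x" for x
    using bij by (auto simp: bij_def surj_f_inv_f)
  note B = filiform[unfolded one_parametric_filiform_def, THEN conjunct2, THEN conjunct1]
  have zero: "\<phi> 0 = 0" using lin by (metis Vector_Spaces.linear_iff scale_zero_left)
  have "\<phi> ` A = {0} \<longleftrightarrow> A = {0}" for A
    using inj_image_eq_iff[OF bij_is_inj[OF bij], of A "{0}"] zero by simp
  then have "grading_support G L = grading_support G (degree_grading scale n e d)"
    unfolding grading_support_def using L by (auto simp: zero)
  then have supp: "grading_support G L = d ` {1..n}"
    using degree_grading_support[OF vector_space_axioms B d] by simp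
  have supp': "grading_support H (degree_grading scale n e d') = d' ` {1..n}"
    using degree_grading_support[OF vector_space_axioms B d'] by simp
  \<comment> \<open>This sends \<open>d j\<close> to \<open>d' j\<close>; by \<open>same\<close>,
    the index picked by \<open>inv_into\<close> does not affect the value.\<close>
  define \<sigma> where "\<sigma> = d' \<circ> inv_into {1..n} d"
  have \<sigma>: "\<sigma> (d j) = d' j" if "j \<in> {1..n}" for j
  proof -
    have "inv_into {1..n} d (d j) \<in> {1..n}" "d (inv_into {1..n} d (d j)) = d j"
      using that by (auto intro!: inv_into_into f_inv_into_f simp del: atLeastAtMost_iff)
    then show ?thesis unfolding \<sigma>_def o_def using same that by blast
  qed
  have "bij_betw \<sigma> (d ` {1..n}) (d' ` {1..n})"
  proof (rule bij_betw_imageI)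
    show "inj_on \<sigma> (d ` {1..n})" using \<sigma> same by (intro inj_onI) (metis imageE)
    show "\<sigma> ` d ` {1..n} = d' ` {1..n}" unfolding image_image using \<sigma> by (intro image_cong) auto
  qed
  moreover have "algebra_automorphism scale mul (inv_into UNIV \<phi>)"
    unfolding algebra_automorphism_def
  proof (intro conjI allI)
    show "bij (inv_into UNIV \<phi>)" using bij by (rule bij_imp_bij_inv)
    show "inv_into UNIV \<phi> (mul x y) = mul (inv_into UNIV \<phi> x) (inv_into UNIV \<phi> y)" for x y
      by (metis inv mult)
    have "inv_into UNIV \<phi> (x + y) = inv_into UNIV \<phi> x + inv_into UNIV \<phi> y" "inv_into UNIV \<phi> (scale c x) = scale c (inv_into UNIV \<phi> x)" for x y c
      using lin unfolding Vector_Spaces.linear_iff by (metis inv)+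
    then show "Vector_Spaces.linear scale scale (inv_into UNIV \<phi>)"
      using vector_space_axioms by (simp add: Vector_Spaces.linear_iff)
  qed
  moreover have "inv_into UNIV \<phi> ` L k = degree_grading scale n e d' (\<sigma> k)" if k: "k \<in> d ` {1..n}" for k
  proof -
    obtain i where i: "i \<in> {1..n}" "k = d i" using k by blast
    have "{j \<in> {1..n}. d j = d i} = {j \<in> {1..n}. d' j = d' i}" using same i by blast
    then have "degree_grading scale n e d k = degree_grading scale n e d' (\<sigma> k)"
      using i \<sigma> by (simp add: degree_grading_def)
    moreover have "inv_into UNIV \<phi> ` L k = degree_grading scale n e d k"
      using L[of k] d i by (simp add: image_image inv)
    ultimately show ?thesis by simp
  qed
  ultimately show ?thesis
    unfolding equivalent_gradings_def supp supp' using grading H by blast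
qed

text \<open>Let \<open>t\<close> be the order of \<open>g\<close>. If \<open>t = 1\<close>, the
  outcome is the trivial grading for \<open>h = \<one>\<close> and (A) otherwise. If
  \<open>t \<noteq> 1\<close>, it is (B) for \<open>h = \<one>\<close>, (D) for any other power of
  \<open>g\<close>, and (C) for \<open>h\<close> outside the subgroup generated by
  \<open>g\<close>.\<close>

lemma grading_cases:
  "equivalent_gradings scale mul G L
           (integer_mod_group 1) (trivial_grading (integer_mod_group 1)) \<or>
         equivalent_gradings scale mul G L
           (integer_mod_group 2) (degree_grading scale n e degA) \<or>
         (\<exists>t. t dvd n - 3 \<and> t \<noteq> 1 \<and>
           (equivalent_gradings scale mul G L
              (integer_mod_group t) (degree_grading scale n e (degB t)) \<or>
            equivalent_gradings scale mul G L
              (integer_mod_group t \<times>\<times> integer_group) (degree_grading scale n e (degC t)) \<or>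
            (\<exists>\<tau>\<in>{0..t - 2}. equivalent_gradings scale mul G L
              (integer_mod_group t) (degree_grading scale n e (degD t \<tau>)))))"
proof -
  obtain g h \<phi> where g: "g \<in> carrier G" and h: "h \<in> carrier G" and gn: "g [^] (n - 3) = \<one>"
    and aut: "algebra_automorphism scale mul \<phi>"
    and L: "\<And>k. k \<in> carrier G \<Longrightarrow>
      L k = \<phi> ` degree_grading scale n e (\<lambda>j. if j = 1 then g else h \<otimes> g [^] (j - 2)) k"
    by (rule canonical_form, rule that)
  let ?d = "\<lambda>j. if j = 1 then g else h \<otimes> g [^] (j - 2 :: nat)"
  have d: "?d j \<in> carrier G" for j using g h by simp
  note equivalent = equivalent_to_degree_grading[OF aut L d]
  define t where "t = ord g"
  have t: "t dvd n - 3" using gn g by (simp add: t_def pow_eq_id)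
  \<comment> \<open>\<open>ord\<close> is 0 for elements of infinite order, which is excluded
    because \<open>t\<close> divides the positive number \<open>n - 3\<close>.\<close>
  have t0: "t > 0" using degree_mod_t[OF t n] by simp
  have pow: "g [^] (a::int) = g [^] b \<longleftrightarrow> a mod int t = b mod int t" for a b
    using int_pow_eq[OF g, of b a] unfolding t_def mod_eq_dvd_iff by metis
  have nat_pow: "g [^] (a::nat) = g [^] int a" for a by (simp add: int_pow_int)
  show ?thesis
  proof (cases "t = 1")
    case True
    then have g1: "g = \<one>" using ord_eq_1[OF g] by (simp add: t_def)
    show ?thesis
    proof (cases "h = \<one>")
      case True
      have "comm_group (integer_mod_group 1)" "carrier (integer_mod_group 1) = {\<one>\<^bsub>integer_mod_group 1\<^esub>}"
        by (auto simp: carrier_integer_mod_group)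
      then have "abelian_group_grading scale mul (integer_mod_group 1) (trivial_grading (integer_mod_group 1))"
        by (intro trivial_grading_abelian_group_grading vector_space_axioms)
      \<comment> \<open>Read as a degree grading with all degrees 0, the trivial grading falls under
        the same criterion.\<close>
      moreover have "trivial_grading (integer_mod_group 1) = degree_grading scale n e (\<lambda>_. 0 :: int)"
      proof
        fix k :: int
        have "{j \<in> {1..n}. 0 = k} = (if k = 0 then {1..n} else {})" by auto
        then show "trivial_grading (integer_mod_group 1) k = degree_grading scale n e (\<lambda>_. 0) k"
          using basis_span by (simp add: trivial_grading_def degree_grading_def)
      qed
      ultimately have "equivalent_gradings scale mul G L
          (integer_mod_group 1) (trivial_grading (integer_mod_group 1))"
        using True g1 equivalent[where d' = "\<lambda>_. 0" and H = "integer_mod_group 1"]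
        by (simp add: carrier_integer_mod_group)
      then show ?thesis by blast
    next
      case False
      have "equivalent_gradings scale mul G L (integer_mod_group 2) (degree_grading scale n e degA)"
      proof (rule equivalent[OF _ gradingA[OF filiform]])
        show "?d i = ?d j \<longleftrightarrow> degA i = degA j" for i j
          using False h by (auto simp: g1 degA_def)
      qed (use n in \<open>auto simp: degA_def carrier_integer_mod_group\<close>)
      then show ?thesis by blast
    qed
  next
    case t1: False
    have *: "\<exists>\<tau>\<in>{0..t - 2}. equivalent_gradings scale mul G L
              (integer_mod_group t) (degree_grading scale n e (degD t \<tau>))"
      if k: "h = g [^] k" "0 < k" "k < int t" for k
    proof (intro bexI)
      \<comment> \<open>Solves \<open>j - 3 - \<tau> = k + (j - 2) - t\<close>, which is the
        exponent of \<open>g\<close> for \<open>e j\<close> up to a multiple of \<open>t\<close>.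
        The bounds \<open>0 < k < t\<close> place \<tau> between 0 and \<open>t - 2\<close>.\<close>
      let ?\<tau> = "nat (int t - 1 - k)"
      define m where "m j = (if j = 1 then 1 else k + int (j - 2))" for j :: nat
      have deg: "degD t ?\<tau> j = m j mod int t" if "j \<in> {1..n}" for j
      proof (cases "j = 1")
        case False
        then have "int j - 3 - int ?\<tau> = k + int (j - 2) - int t" using that k by auto
        then show ?thesis using False by (simp add: degD_def m_def)
      qed (simp add: degD_def m_def)
      have d_pow: "?d j = g [^] m j" for j
        using g by (simp add: k(1) m_def nat_pow int_pow_mult)
      show "equivalent_gradings scale mul G L (integer_mod_group t) (degree_grading scale n e (degD t ?\<tau>))"
      proof (rule equivalent[OF _ gradingD[OF filiform n t]])
        show "degD t ?\<tau> j \<in> carrier (integer_mod_group t)" for j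
          using t0 by (simp add: degD_def carrier_integer_mod_group)
        show "?d i = ?d j \<longleftrightarrow> degD t ?\<tau> i = degD t ?\<tau> j" if "i \<in> {1..n}" "j \<in> {1..n}" for i j
          unfolding d_pow pow deg[OF that(1)] deg[OF that(2)] ..
      qed
      show "?\<tau> \<in> {0..t - 2}" using k t0 t1 by auto
    qed
    show ?thesis
    proof (cases "\<exists>k::int. h = g [^] k")
      case True
      then obtain k0 :: int where k0: "h = g [^] k0" by blast
      define k where "k = k0 mod int t"
      have k: "h = g [^] k" "0 \<le> k" "k < int t"
        using t0 by (simp_all add: k0 k_def pow)
      show ?thesis
      proof (cases "k = 0")
        case True
        define m where "m j = (if j = 1 then 1 else int (j - 2))" for j :: nat
        have deg: "degB t j = m j mod int t" if "j \<in> {1..n}" for j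
          using that by (auto simp: degB_def m_def of_nat_diff)
        have d_pow: "?d j = g [^] m j" for j
          using g by (simp add: k(1) True m_def nat_pow)
        have "equivalent_gradings scale mul G L (integer_mod_group t) (degree_grading scale n e (degB t))"
        proof (rule equivalent[OF _ gradingB[OF filiform n t]])
          show "degB t j \<in> carrier (integer_mod_group t)" for j
            using t0 by (simp add: degB_def carrier_integer_mod_group)
          show "?d i = ?d j \<longleftrightarrow> degB t i = degB t j" if "i \<in> {1..n}" "j \<in> {1..n}" for i j
            unfolding d_pow pow deg[OF that(1)] deg[OF that(2)] ..
        qed
        then show ?thesis using t t1 by blast
      next
        case False
        then have "0 < k" using k by simp
        from *[OF k(1) this k(3)] show ?thesis using t t1 by blast
      qed
    next
      case False
      \<comment> \<open>Otherwise \<open>h\<close> would be the power of \<open>g\<close> with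
        exponent \<open>1 - m\<close>. So \<open>e 1\<close> shares its degree with no other basis
        element, as in (C), where the second component separates it.\<close>
      have ne: "g \<noteq> h \<otimes> g [^] m" for m :: nat
      proof
        assume "g = h \<otimes> g [^] m"
        then have "h = g \<otimes> inv (g [^] m)" using g h inv_solve_right[of h g "g [^] m"] by blast
        also have "\<dots> = g [^] (1 - int m)" using g by (simp add: int_pow_diff nat_pow)
        finally show False using False by blast
      qed
      have "?d i = ?d j \<longleftrightarrow> degC t i = degC t j" if "i \<in> {1..n}" "j \<in> {1..n}" for i j
      proof (cases "i = 1 \<or> j = 1")
        case True
        then show ?thesis using ne[of "i - 2"] ne[of "j - 2"] by (auto simp: degC_def)
      next
        case False
        then have "?d i = ?d j \<longleftrightarrow> int (i - 2) mod int t = int (j - 2) mod int t"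
          using g h by (simp add: nat_pow pow)
        \<comment> \<open>Lowering both numbers by one preserves congruence; this absorbs the offset
          3 in \<open>degC\<close>.\<close>
        also have "\<dots> \<longleftrightarrow> (int i - 3) mod int t = (int j - 3) mod int t"
          using False that by (simp add: mod_eq_dvd_iff of_nat_diff)
        finally show ?thesis using False by (simp add: degC_def)
      qed
      then have "equivalent_gradings scale mul G L
          (integer_mod_group t \<times>\<times> integer_group) (degree_grading scale n e (degC t))"
        using t0 by (intro equivalent[OF _ gradingC[OF filiform n t]])
          (assumption, simp add: degC_def carrier_integer_mod_group, blast)
      then show ?thesis using t t1 by blast
    qed
  qed
qed

end

theorem theorem19:
  fixes scale :: "complex \<Rightarrow> 'a::ab_group_add \<Rightarrow> 'a"
    and mul :: "'a \<Rightarrow> 'a \<Rightarrow> 'a"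
    and n :: nat
    and \<theta> :: complex
    and e :: "nat \<Rightarrow> 'a"
    and G :: "('g, 'm) monoid_scheme"
    and L :: "'g \<Rightarrow> 'a set"
  assumes "\<theta> \<noteq> 0"
    and "one_parametric_filiform scale mul n \<theta> e"
    and "abelian_group_grading scale mul G L"
  shows
    "(n = 4 \<longrightarrow>
        equivalent_gradings scale mul G L
          (integer_mod_group 1) (trivial_grading (integer_mod_group 1)) \<or>
        equivalent_gradings scale mul G L
          (integer_mod_group 2) (degree_grading scale n e degA)) \<and>
     (n \<ge> 5 \<longrightarrow>
        equivalent_gradings scale mul G L
          (integer_mod_group 1) (trivial_grading (integer_mod_group 1)) \<or>
        equivalent_gradings scale mul G L
          (integer_mod_group 2) (degree_grading scale n e degA) \<or>
        (\<exists>t. t dvd n - 3 \<and> t \<noteq> 1 \<and>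
           equivalent_gradings scale mul G L
             (integer_mod_group t) (degree_grading scale n e (degB t))) \<or>
        (\<exists>t. t dvd n - 3 \<and> t \<noteq> 1 \<and>
           equivalent_gradings scale mul G L
             (integer_mod_group t \<times>\<times> integer_group) (degree_grading scale n e (degC t))) \<or>
        (\<exists>t \<tau>. t dvd n - 3 \<and> t \<noteq> 1 \<and> \<tau> \<in> {0..t - 2} \<and>
           equivalent_gradings scale mul G L
             (integer_mod_group t) (degree_grading scale n e (degD t \<tau>))))"
proof (cases "4 \<le> n")
  case True
  have "graded_filiform scale mul n \<theta> e G L"
    unfolding graded_filiform_def filiform_algebra_def filiform_algebra_axioms_def
      graded_algebra_def graded_algebra_axioms_def
    using assms True
    by (auto simp: one_parametric_filiform_def complex_algebra_def abelian_group_grading_def)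
  note cases = graded_filiform.grading_cases[OF this]
  show ?thesis
  proof (intro conjI impI)
    \<comment> \<open>Here \<open>n - 3 = 1\<close> has no divisor other than 1, so (B), (C) and (D)
      are empty.\<close>
    assume "n = 4"
    then show "equivalent_gradings scale mul G L
          (integer_mod_group 1) (trivial_grading (integer_mod_group 1)) \<or>
        equivalent_gradings scale mul G L
          (integer_mod_group 2) (degree_grading scale n e degA)"
      using cases by auto
  qed (use cases in blast)
qed auto

end
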